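(* Let $R$ be a proper $*$-ring, let $a\in R$ and let $k$ be a positive integer. If $a^k$ is core invertible, then $a$ is weak core invertible and $a^{\boxplus}=a^{k-1}(a^k)^{\mathrm{core}}$, where $(a^k)^{\mathrm{core}}$ denotes the core inverse of $a^k$.
   Context: A proper $*$-ring is a (not necessarily commutative) ring $R$ with unit $1\ne 0$ and an involution $r\mapsto r^*$ satisfying $(r^* )^*=r$, $(r+s)^*=r^*+s^*$, $(rs)^*=s^*r^*$, such that $r^*r=0$ implies $r=0$. By convention $a^0=1$. The core inverse $b^{\mathrm{core}}$ of $b\in R$ is the (unique, if it exists) $z\in R$ with $(bz)^*=bz$, $zb^2=b$ and $bz^2=z$; $b$ is then called core invertible. An element $y\in R$ is a weak core inverse of $a\in R$ if for some positive integer $k$ one has $ya^{k+1}=a^k$, $ay^2=y$ and $(a^k)^*ay=(a^k)^*$. In a proper $*$-ring it is unique if it exists and is denoted $a^{\boxplus}$; $a$ is then called weak core invertible. *)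

theory Defs
  imports Main
begin

class star_ring = ring_1 +
  fixes star :: "'a \<Rightarrow> 'a"
  assumes star_star: "star (star r) = r"
    and star_add: "star (r + s) = star r + star s"
    and star_mult: "star (r * s) = star s * star r"

class proper_star_ring = star_ring +
  assumes star_proper: "star r * r = 0 \<Longrightarrow> r = 0"

definition is_core_inverse :: "'a::star_ring \<Rightarrow> 'a \<Rightarrow> bool" where
  "is_core_inverse b z \<longleftrightarrow> star (b * z) = b * z \<and> z * b ^ 2 = b \<and> b * z ^ 2 = z"

definition core_invertible :: "'a::star_ring \<Rightarrow> bool" where
  "core_invertible b \<longleftrightarrow> (\<exists>z. is_core_inverse b z)"

text \<open>The description operators below are meaningful only for (weak) core invertible elements;
  the uniqueness they rely on is \<open>is_core_inverse_unique\<close> and \<open>is_weak_core_inverse_unique\<close>.\<close>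

definition core_inverse :: "'a::star_ring \<Rightarrow> 'a" where
  "core_inverse b = (THE z. is_core_inverse b z)"

definition is_weak_core_inverse :: "'a::star_ring \<Rightarrow> 'a \<Rightarrow> bool" where
  "is_weak_core_inverse a y \<longleftrightarrow>
     (\<exists>k::nat. k > 0 \<and> y * a ^ (k + 1) = a ^ k \<and> a * y ^ 2 = y
        \<and> star (a ^ k) * a * y = star (a ^ k))"

definition weak_core_invertible :: "'a::star_ring \<Rightarrow> bool" where
  "weak_core_invertible a \<longleftrightarrow> (\<exists>y. is_weak_core_inverse a y)"

definition weak_core_inverse :: "'a::star_ring \<Rightarrow> 'a" where
  "weak_core_inverse a = (THE y. is_weak_core_inverse a y)"

lemma is_core_inverse_unique:
  fixes b z w :: "'a::star_ring"
  assumes z: "is_core_inverse b z" and w: "is_core_inverse b w"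
  shows "z = w"
proof -
  have inner: "b * x * b = b" and outer: "x * b * x = x" if "is_core_inverse b x" for x
  proof -
    have 1: "x * (b * b) = b" and 2: "b * (x * x) = x"
      using that by (simp_all add: is_core_inverse_def power2_eq_square)
    have "b * x * b = (b * (x * x)) * (b * b)" using 1 by (metis mult.assoc)
    then show "b * x * b = b" using 1 2 by simp
    have "x * b * x = (x * (b * b)) * (x * x)" using 2 by (metis mult.assoc)
    then show "x * b * x = x" using 1 2 by simp
  qed
  have zw: "(b * z) * (b * w) = b * w"
    using inner[OF z] by (metis mult.assoc)
  have wz: "(b * w) * (b * z) = b * z"
    using inner[OF w] by (metis mult.assoc)
  have eq: "b * z = b * w"
    using zw wz z w by (metis is_core_inverse_def star_mult)
  have "z = z * (b * z)" using outer[OF z] by (simp add: mult.assoc)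
  also have "\<dots> = z * b * (b * (w * w))"
    using eq w by (simp add: is_core_inverse_def power2_eq_square mult.assoc)
  also have "\<dots> = (z * b ^ 2) * (w * w)"
    by (simp add: power2_eq_square mult.assoc)
  also have "\<dots> = w"
    using z w by (simp add: is_core_inverse_def power2_eq_square)
  finally show ?thesis .
qed

lemma is_weak_core_inverse_unique:
  fixes a x y :: "'a::star_ring"
  assumes x: "is_weak_core_inverse a x" and y: "is_weak_core_inverse a y"
  shows "x = y"
proof -
  define P where "P m u \<longleftrightarrow> u * a ^ (m + 1) = a ^ m \<and> a * u ^ 2 = u
      \<and> star (a ^ m) * a * u = star (a ^ m)" for m :: nat and u
  have mono: "P (m + d) u" if "P m u" for m d u
  proof -
    have "u * a ^ (m + d + 1) = (u * a ^ (m + 1)) * a ^ d"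
      by (simp add: mult.assoc flip: power_add)
    then have "u * a ^ (m + d + 1) = a ^ (m + d)"
      using that by (simp only: P_def power_add)
    moreover have "star (a ^ (m + d)) = star (a ^ d) * star (a ^ m)"
      by (simp add: power_add star_mult)
    ultimately show ?thesis
      using that unfolding P_def by (simp only: mult.assoc)
  qed
  obtain i j where "P i x" "P j y"
    using x y unfolding is_weak_core_inverse_def P_def by blast
  then have "P (i + j) x" "P (i + j) y"
    using mono[of i x j] mono[of j y i] by (simp_all add: add.commute)
  then obtain m where Px: "P m x" and Py: "P m y" by blast
  have pow: "a ^ n * u ^ Suc n = u" if "P m u" for u n
  proof (induction n)
    case (Suc n)
    have "a ^ Suc n * u ^ Suc (Suc n) = a ^ n * (a * u ^ 2) * u ^ n"
      by (simp only: power_Suc2[of a] power_Suc[of u] power2_eq_square mult.assoc)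
    also have "\<dots> = a ^ n * u ^ Suc n"
      using that by (simp add: P_def mult.assoc)
    finally show ?case using Suc by simp
  qed simp
  have herm: "star (a * u) = star (a * u) * (a * v)" if "P m u" "P m v" for u v
  proof -
    define w where "w = a * u ^ Suc m"
    have "a * u = a * (a ^ m * u ^ Suc m)"
      using pow[OF that(1), of m] by simp
    also have "\<dots> = a ^ m * w"
      unfolding w_def by (simp only: power_commutes flip: mult.assoc)
    finally have "star (a * u) = star w * star (a ^ m)"
      by (simp only: star_mult)
    moreover have "star (a ^ m) * (a * v) = star (a ^ m)"
      using that(2) by (simp add: P_def mult.assoc)
    ultimately show ?thesis by (simp add: mult.assoc)
  qed
  have self: "star (a * u) = a * u" if "P m u" for u
    using herm[OF that that] star_mult[of "star (a * u)" "a * u"] by (simp only: star_star)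
  have xy: "a * x = (a * x) * (a * y)" and yx: "a * y = (a * y) * (a * x)"
    using herm[OF Px Py] herm[OF Py Px] by (simp_all only: self[OF Px] self[OF Py])
  have "a * y = star ((a * y) * (a * x))"
    using yx self[OF Py] by simp
  also have "\<dots> = (a * x) * (a * y)"
    by (simp only: star_mult[of "a * y"] self[OF Px] self[OF Py])
  finally have eq: "a * x = a * y" using xy by simp
  have step: "u * (a * v) = v" if "P m u" "P m v" for u v
  proof -
    have "a * v = a ^ (m + 1) * v ^ Suc m"
      using pow[OF that(2), of m] by (simp add: mult.assoc)
    then have "u * (a * v) = (u * a ^ (m + 1)) * v ^ Suc m"
      by (simp only: mult.assoc)
    also have "u * a ^ (m + 1) = a ^ m"
      using that(1) unfolding P_def by blast
    also have "a ^ m * v ^ Suc m = v"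
      by (rule pow[OF that(2)])
    finally show ?thesis .
  qed
  have "x = x * (a * x)" by (rule step[OF Px Px, symmetric])
  also have "\<dots> = x * (a * y)" by (simp only: eq)
  also have "\<dots> = y" by (rule step[OF Px Py])
  finally show ?thesis .
qed

end

theory Submission
  imports Defs
begin

text \<open>
  Write \<open>b = a ^ k\<close>, let \<open>z\<close> be the core inverse of \<open>b\<close> and put \<open>y = a ^ (k - 1) * z\<close>. Then \<open>y\<close>
  satisfies the equations of a weak core inverse at the exponent \<open>k\<close> itself. Two of them rest on
  \<open>a * y = b * z\<close>, the Hermitian idempotent that fixes \<open>b\<close>, and hence all of \<open>b * R\<close>, by left
  multiplication: adjoining \<open>b * z * b = b\<close> gives \<open>star b * (a * y) = star b\<close>, and
  \<open>a * y\<^sup>2 = y\<close> holds because \<open>y\<close> lies in \<open>b * R\<close>.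

  The remaining equation \<open>y * a ^ (k + 1) = b\<close> is about moving \<open>z\<close> past a power of \<open>a\<close>. Although
  \<open>z\<close> need not commute with \<open>a\<close>, it cancels one factor of \<open>b\<^sup>2\<close> on its right, so the idea is to
  produce \<open>b\<^sup>2\<close> there: \<open>b\<close> lies in \<open>b\<^sup>2 * R\<close>, and \<open>a\<close> commutes with \<open>b\<^sup>2\<close>. Uniqueness of both
  inverses then identifies the values of the description operators.
\<close>

lemma core_inverse_eqI:
  "is_core_inverse b z \<Longrightarrow> core_inverse b = z"
  unfolding core_inverse_def by (blast intro: is_core_inverse_unique)

lemma weak_core_inverse_eqI:
  "is_weak_core_inverse a y \<Longrightarrow> weak_core_inverse a = y"
  unfolding weak_core_inverse_def by (blast intro: is_weak_core_inverse_unique)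

lemma core_inverse_inner:
  assumes "is_core_inverse b z"
  shows "b * z * b = b"
proof -
  have 1: "z * (b * b) = b" and 2: "b * (z * z) = z"
    using assms by (simp_all add: is_core_inverse_def power2_eq_square)
  have "b * z * b = b * z * (z * (b * b))"
    by (simp only: 1)
  also have "\<dots> = b * (z * z) * (b * b)"
    by (simp only: mult.assoc)
  also have "\<dots> = b"
    by (simp only: 1 2)
  finally show ?thesis .
qed

text \<open>
  The factor \<open>z\<^sup>2 * b\<close> is the group inverse of \<open>b\<close>; the identity says that a core invertible element
  lies in \<open>b\<^sup>2 * R\<close>, complementing the axiom \<open>z * b\<^sup>2 = b\<close>, which puts it in \<open>R * b\<^sup>2\<close>.
\<close>

lemma core_inverse_square_left:
  assumes "is_core_inverse b z"
  shows "b * b * (z * z * b) = b"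
proof -
  have "b * b * (z * z * b) = b * (b * (z * z)) * b"
    by (simp only: mult.assoc)
  also have "\<dots> = b * z * b"
    using assms by (simp add: is_core_inverse_def power2_eq_square)
  finally show ?thesis
    using core_inverse_inner[OF assms] by simp
qed

lemma is_weak_core_inverse_of_power:
  fixes a z :: "'a::star_ring"
  assumes "k > 0" and z: "is_core_inverse (a ^ k) z"
  shows "is_weak_core_inverse a (a ^ (k - 1) * z)"
proof -
  define b where "b = a ^ k"
  define c where "c = a ^ (k - 1)"
  define y where "y = c * z"
  have herm: "star (b * z) = b * z" and left: "z * (b * b) = b" and right: "b * (z * z) = z"
    using z by (simp_all add: is_core_inverse_def power2_eq_square b_def)
  have inner: "b * z * b = b" and square: "b * b * (z * z * b) = b"
    using core_inverse_inner[OF z] core_inverse_square_left[OF z] by (simp_all add: b_def)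
  have ac: "a * c = b" and ca: "c * a = b"
    using \<open>k > 0\<close> by (cases k; simp add: b_def c_def power_commutes)+
  have ab: "a * b = b * a" and cb: "c * b = b * c"
    by (simp_all add: b_def c_def power_commutes add.commute flip: power_add)
  have ay: "a * y = b * z"
    by (simp add: y_def ac flip: mult.assoc)

  have "y * a ^ (k + 1) = b"
  proof -
    have "z * (a * b) = z * (a * (b * b * (z * z * b)))"
      by (simp only: square)
    also have "\<dots> = z * (a * b * b) * (z * z * b)"
      by (simp only: mult.assoc)
    also have "a * b * b = b * b * a"
      by (simp only: ab mult.assoc)
    also have "z * (b * b * a) * (z * z * b) = z * (b * b) * a * (z * z * b)"
      by (simp only: mult.assoc)
    finally have "z * (a * b) = b * a * (z * z * b)"
      by (simp only: left)
    then have "y * (a * b) = c * b * a * (z * z * b)"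
      by (simp only: y_def mult.assoc)
    also have "\<dots> = b * (c * a) * (z * z * b)"
      by (simp only: cb mult.assoc)
    also have "\<dots> = b"
      by (simp only: ca square)
    finally show ?thesis
      by (simp add: b_def)
  qed

  moreover have "a * y ^ 2 = y"
  proof -
    have "y = c * (b * (z * z))"
      by (simp only: y_def right)
    also have "\<dots> = c * b * (z * z)"
      by (simp only: mult.assoc)
    finally have y: "y = b * (c * (z * z))"
      by (simp only: cb mult.assoc)
    have "a * y ^ 2 = b * z * y"
      by (simp add: power2_eq_square ay flip: mult.assoc)
    also have "\<dots> = b * z * b * (c * (z * z))"
      by (subst y) (simp only: mult.assoc)
    finally show ?thesis
      using y by (simp only: inner)
  qed

  moreover have "star b * a * y = star b"
  proof -
    have "star b * (a * y) = star (b * z * b)"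
      by (simp only: ay star_mult[of "b * z" b] herm)
    also have "\<dots> = star b"
      by (simp only: inner)
    finally show ?thesis
      by (simp only: mult.assoc)
  qed

  ultimately show ?thesis
    using \<open>k > 0\<close> unfolding is_weak_core_inverse_def y_def b_def c_def by blast
qed

theorem theorem3p17:
  fixes a :: "'a::proper_star_ring" and k :: nat
  assumes "k > 0" and "core_invertible (a ^ k)"
  shows "weak_core_invertible a
    \<and> weak_core_inverse a = a ^ (k - 1) * core_inverse (a ^ k)"
proof -
  obtain z where z: "is_core_inverse (a ^ k) z"
    using assms(2) unfolding core_invertible_def by blast
  then have "is_weak_core_inverse a (a ^ (k - 1) * core_inverse (a ^ k))"
    using is_weak_core_inverse_of_power[OF assms(1) z] by (simp add: core_inverse_eqI)
  then show ?thesis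
    unfolding weak_core_invertible_def by (blast intro: weak_core_inverse_eqI)
qed

end
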